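(* Let $f=\sum_{\sigma\in S_d}\lambda_\sigma x_{\sigma(1)}\cdots x_{\sigma(d)}\in \mathbb C\langle X\rangle$ be a multilinear polynomial of degree $d\ge 2$ with $\sum_{\sigma\in S_d}\lambda_\sigma\neq 0$, and let $\mathcal A$ be a unital $C^*$-algebra. If $\phi:\mathcal A\to\mathcal A$ is a continuous surjective linear map that preserves zeros of $f$ and satisfies $\phi(1)\in\mathbb C^*\cdot 1$, then $\phi$ is a scalar multiple of a Jordan epimorphism, i.e., $\phi=\alpha\theta$ for some $\alpha\in\mathbb C$ and some surjective linear map $\theta:\mathcal A\to\mathcal A$ with $\theta(a^2)=\theta(a)^2$ for all $a\in\mathcal A$.
   Context: $\mathbb C\langle X\rangle$ is the free algebra over $\mathbb C$ in noncommuting indeterminates $x_1,x_2,\ldots$. A map $\phi$ on $\mathcal A$ preserves zeros of $f$ if for all $a_1,\ldots,a_d\in\mathcal A$, $f(a_1,\ldots,a_d)=0$ implies $f(\phi(a_1),\ldots,\phi(a_d))=0$. *)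

theory Defs
  imports "HOL-Analysis.Analysis"
begin

class cstar_algebra = real_normed_algebra_1 + banach +
  fixes cscale :: "complex \<Rightarrow> 'a \<Rightarrow> 'a"
    and star :: "'a \<Rightarrow> 'a"
  assumes cscale_of_real: "cscale (of_real r) a = scaleR r a"
    and cscale_add_left: "cscale (c + d) a = cscale c a + cscale d a"
    and cscale_add_right: "cscale c (a + b) = cscale c a + cscale c b"
    and cscale_mult: "cscale (c * d) a = cscale c (cscale d a)"
    and cscale_one: "cscale 1 a = a"
    and cscale_left_mult: "cscale c (a * b) = cscale c a * b"
    and cscale_right_mult: "cscale c (a * b) = a * cscale c b"
    and norm_cscale: "norm (cscale c a) = cmod c * norm a"
    and star_star: "star (star a) = a"
    and star_add: "star (a + b) = star a + star b"
    and star_mult: "star (a * b) = star b * star a"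
    and star_cscale: "star (cscale c a) = cscale (cnj c) (star a)"
    and cstar_identity: "norm (star a * a) = (norm a)\<^sup>2"

instantiation complex :: cstar_algebra
begin
definition cscale_complex :: "complex \<Rightarrow> complex \<Rightarrow> complex" where "cscale_complex c a = c * a"
definition star_complex :: "complex \<Rightarrow> complex" where "star_complex = cnj"
instance
  by standard (auto simp: cscale_complex_def star_complex_def scaleR_conv_of_real
      algebra_simps norm_mult power2_eq_square)
end

definition clinear_map :: "('a::cstar_algebra \<Rightarrow> 'a) \<Rightarrow> bool" where
  "clinear_map \<phi> \<longleftrightarrow> (\<forall>a b. \<phi> (a + b) = \<phi> a + \<phi> b) \<and> (\<forall>c a. \<phi> (cscale c a) = cscale c (\<phi> a))"

definition multilin_eval :: "nat \<Rightarrow> ((nat \<Rightarrow> nat) \<Rightarrow> complex) \<Rightarrow> (nat \<Rightarrow> 'a::cstar_algebra) \<Rightarrow> 'a" where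
  "multilin_eval d lam a =
     (\<Sum>\<sigma>\<in>{\<sigma>. \<sigma> permutes {0..<d}}. cscale (lam \<sigma>) (prod_list (map (\<lambda>i. a (\<sigma> i)) [0..<d])))"

definition preserves_zeros :: "nat \<Rightarrow> ((nat \<Rightarrow> nat) \<Rightarrow> complex) \<Rightarrow> ('a::cstar_algebra \<Rightarrow> 'a) \<Rightarrow> bool" where
  "preserves_zeros d lam \<phi> \<longleftrightarrow>
     (\<forall>a. multilin_eval d lam a = 0 \<longrightarrow> multilin_eval d lam (\<phi> \<circ> a) = 0)"

end

theory Submission
  imports Defs
begin

text \<open>
  After rescaling, \<open>\<phi> 1 = 1\<close>. Evaluating \<open>f\<close> at \<open>(p, q, 1, \<dots>, 1)\<close> shows that \<open>p q = q p = 0\<close>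
  implies \<open>\<phi> p \<phi> q + \<phi> q \<phi> p = 0\<close>. Hence \<open>Q x = (\<phi> x)\<^sup>2 - \<phi> (x\<^sup>2)\<close> is additive on orthogonal
  pairs; it is also invariant under translation by scalars. A self-adjoint contraction \<open>h\<close> is
  \<open>p - q\<close> with \<open>p\<close>, \<open>q\<close> its positive and negative parts, so
  \<open>Q h = Q p + Q q = (Q (2 p - 1) + Q (2 q - 1)) / 4\<close>, where \<open>2 p - 1\<close> and \<open>2 q - 1\<close> are again
  self-adjoint contractions. Any bound for \<open>Q\<close> on self-adjoint contractions can thus be halved,
  so \<open>Q\<close> vanishes on self-adjoint elements, and by polarization everywhere.
\<close>

subsection \<open>Elementary facts on \<open>C\<^sup>*\<close>-algebras\<close>

lemma cscale_zero_right [simp]: "cscale c (0::'a::cstar_algebra) = 0"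
  using cscale_add_right[of c 0 "0::'a"] by simp

lemma cscale_minus_right: "cscale c (- a) = - cscale c (a::'a::cstar_algebra)"
  using cscale_add_right[of c a "- a"] by (simp add: eq_neg_iff_add_eq_0 add.commute)

lemma cscale_diff_right: "cscale c (a - b) = cscale c a - cscale c (b::'a::cstar_algebra)"
  using cscale_add_right[of c a "- b"] by (simp add: cscale_minus_right)

lemma cscale_sum_right: "cscale c (sum g A) = (\<Sum>x\<in>A. cscale c (g x :: 'a::cstar_algebra))"
  by (induction A rule: infinite_finite_induct) (simp_all add: cscale_add_right)

lemma cscale_zero_left [simp]: "cscale 0 (a::'a::cstar_algebra) = 0"
  using cscale_of_real[of 0 a] by simp

lemma cscale_sum_left: "cscale (sum g A) (a::'a::cstar_algebra) = (\<Sum>x\<in>A. cscale (g x) a)"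
  by (induction A rule: infinite_finite_induct) (simp_all add: cscale_add_left)

lemma cscale_minus_left: "cscale (- c) a = - cscale c (a::'a::cstar_algebra)"
  using cscale_add_left[of c "- c" a] by (simp add: eq_neg_iff_add_eq_0 add.commute)

lemma cscale_scaleR: "cscale c (r *\<^sub>R a) = r *\<^sub>R cscale c (a::'a::cstar_algebra)"
  by (metis cscale_of_real cscale_mult mult.commute)

lemma star_zero [simp]: "star (0::'a::cstar_algebra) = 0"
  using star_add[of 0 "0::'a"] by simp

lemma star_one [simp]: "star (1::'a::cstar_algebra) = 1"
  by (metis star_star star_mult mult_1_left)

lemma star_minus: "star (- a) = - star (a::'a::cstar_algebra)"
  using star_add[of a "- a"] by (simp add: eq_neg_iff_add_eq_0 add.commute)

lemma star_diff: "star (a - b) = star a - star (b::'a::cstar_algebra)"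
  using star_add[of a "- b"] by (simp add: star_minus)

lemma star_scaleR: "star (r *\<^sub>R a) = r *\<^sub>R star (a::'a::cstar_algebra)"
  by (metis cscale_of_real star_cscale complex_cnj_complex_of_real)

lemma star_power: "star (a ^ n) = star (a::'a::cstar_algebra) ^ n"
  by (induction n) (simp_all add: star_mult power_commutes)

text \<open>Isometry of the involution is not an axiom of the class. The C*-identity and
  submultiplicativity give one inequality, and applying it to \<open>star a\<close> gives the
  other.\<close>

lemma norm_star: "norm (star a) = norm (a::'a::cstar_algebra)"
proof -
  have le: "norm x \<le> norm (star x)" for x :: 'a
  proof (cases "x = 0")
    case False
    have "norm x * norm x \<le> norm (star x) * norm x"
      by (metis cstar_identity norm_mult_ineq power2_eq_square)
    then show ?thesis using False by simp
  qed simp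
  show ?thesis using le[of a] le[of "star a"] by (simp add: star_star)
qed

lemma bounded_linear_star: "bounded_linear (star :: 'a::cstar_algebra \<Rightarrow> 'a)"
  by (rule bounded_linear_intro[where K = 1]) (simp_all add: star_add star_scaleR norm_star)

lemma norm_selfadjoint_square:
  assumes "star a = (a::'a::cstar_algebra)" shows "norm (a * a) = (norm a)\<^sup>2"
  using cstar_identity[of a] assms by simp

text \<open>Repeated squaring with the C*-identity. This stands in for the spectral radius formula:
  slow growth of powers will force a bound on the norm itself.\<close>

lemma norm_selfadjoint_power:
  assumes "star a = (a::'a::cstar_algebra)" shows "norm (a ^ (2 ^ m)) = norm a ^ (2 ^ m)"
proof (induction m)
  case (Suc m)
  have "norm (a ^ (2 ^ Suc m)) = norm (a ^ (2 ^ m) * a ^ (2 ^ m))"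
    by (simp add: power_add[symmetric] mult_2)
  also have "\<dots> = (norm (a ^ (2 ^ m)))\<^sup>2"
    by (rule norm_selfadjoint_square) (simp add: star_power assms)
  finally show ?case by (simp add: Suc power_mult[symmetric] mult.commute)
qed simp

subsection \<open>Square roots\<close>

text \<open>Iterates of \<open>b \<mapsto> (z + b\<^sup>2) / 2\<close>, whose fixed points satisfy \<open>(1 - b)\<^sup>2 = 1 - z\<close>.\<close>

primrec sqrt_iter :: "'a::real_algebra \<Rightarrow> nat \<Rightarrow> 'a" where
  "sqrt_iter z 0 = 0"
| "sqrt_iter z (Suc n) = (1/2) *\<^sub>R (z + sqrt_iter z n * sqrt_iter z n)"

lemma sqrt_iter_real_bounds: "0 \<le> sqrt_iter (1::real) n \<and> sqrt_iter (1::real) n \<le> 1"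
  by (induction n) (auto simp: mult_le_one)

lemma norm_sqrt_iter:
  fixes z :: "'a::real_normed_algebra"
  assumes "norm z \<le> 1" shows "norm (sqrt_iter z n) \<le> sqrt_iter 1 n"
proof (induction n)
  case (Suc n)
  have "norm (z + sqrt_iter z n * sqrt_iter z n) \<le> 1 + sqrt_iter 1 n * sqrt_iter 1 n"
    by (intro norm_triangle_le add_mono assms order.trans[OF norm_mult_ineq] mult_mono Suc)
      (simp_all add: sqrt_iter_real_bounds)
  then show ?case by simp
qed simp

text \<open>The iteration with argument \<open>1\<close> in the reals majorizes all others, even for \<open>norm z = 1\<close>,
  where it is no longer a contraction.\<close>

lemma norm_sqrt_iter_diff:
  fixes z :: "'a::real_normed_algebra"
  assumes "norm z \<le> 1"
  shows "norm (sqrt_iter z (Suc n) - sqrt_iter z n) \<le> sqrt_iter 1 (Suc n) - sqrt_iter 1 n"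
proof (induction n)
  case 0
  then show ?case using assms by simp
next
  case (Suc n)
  let ?b = "sqrt_iter z" and ?t = "sqrt_iter (1::real)"
  define d where "d = ?b (Suc n) - ?b n"
  have d: "norm d \<le> ?t (Suc n) - ?t n" unfolding d_def by (rule Suc)
  \<comment> \<open>Difference of squares without commutativity, stated for any real algebra because
    both the iterates in \<open>'a\<close> and the real majorant use it.\<close>
  have step: "(1/2) *\<^sub>R (c + x * x) - (1/2) *\<^sub>R (c + y * y) = (1/2) *\<^sub>R (x * (x - y) + (x - y) * y)"
    for c x y :: "'b::real_algebra"
    by (simp add: algebra_simps)
  have "?b (Suc (Suc n)) - ?b (Suc n) = (1/2) *\<^sub>R (?b (Suc n) * d + d * ?b n)"
    unfolding d_def by (metis step sqrt_iter.simps(2))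
  moreover have "norm (?b (Suc n) * d + d * ?b n)
      \<le> ?t (Suc n) * (?t (Suc n) - ?t n) + (?t (Suc n) - ?t n) * ?t n"
  proof -
    have "norm (?b (Suc n) * d) \<le> ?t (Suc n) * (?t (Suc n) - ?t n)"
      using order.trans[OF norm_mult_ineq mult_mono[OF norm_sqrt_iter[OF assms] d]]
        sqrt_iter_real_bounds norm_ge_zero by blast
    moreover have "norm (d * ?b n) \<le> (?t (Suc n) - ?t n) * ?t n"
      using order.trans[OF norm_mult_ineq mult_mono[OF d norm_sqrt_iter[OF assms]]]
        order.trans[OF norm_ge_zero d] norm_ge_zero by blast
    ultimately show ?thesis by (rule norm_triangle_mono)
  qed
  moreover have "?t (Suc (Suc n)) - ?t (Suc n)
      = (1/2) *\<^sub>R (?t (Suc n) * (?t (Suc n) - ?t n) + (?t (Suc n) - ?t n) * ?t n)"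
    by (metis step sqrt_iter.simps(2))
  ultimately show ?case by (simp del: sqrt_iter.simps)
qed

text \<open>The real majorant is increasing and bounded, so its increments are summable and dominate
  those of \<open>sqrt_iter z\<close>. Since the iteration starts at 0, the telescoping partial sums
  are the iterates.\<close>

lemma convergent_sqrt_iter:
  fixes z :: "'a::{real_normed_algebra, banach}"
  assumes "norm z \<le> 1" shows "convergent (sqrt_iter z)"
proof -
  let ?t = "sqrt_iter (1::real)"
  \<comment> \<open>The majorization for \<open>z = 1\<close> in the reals: the increment bounds a
    norm, hence is nonnegative.\<close>
  have mono: "?t n \<le> ?t (Suc n)" for n
    using order.trans[OF norm_ge_zero norm_sqrt_iter_diff[of "1::real" n]]
    by (simp only: norm_one order_refl diff_ge_0_iff_ge simp_thms)
  have "incseq ?t" by (intro incseq_SucI mono)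
  then obtain l where "?t \<longlonglongrightarrow> l"
    using incseq_convergent[of ?t 1] sqrt_iter_real_bounds by metis
  then have "summable (\<lambda>n. ?t (Suc n) - ?t n)"
    by (rule telescope_summable)
  then have "summable (\<lambda>n. sqrt_iter z (Suc n) - sqrt_iter z n)"
    by (rule summable_comparison_test'[where N = 0]) (rule norm_sqrt_iter_diff[OF assms])
  then have "convergent (\<lambda>n. \<Sum>i<n. sqrt_iter z (Suc i) - sqrt_iter z i)"
    by (simp only: summable_iff_convergent)
  moreover have "(\<Sum>i<n. sqrt_iter z (Suc i) - sqrt_iter z i) = sqrt_iter z n" for n
    using sum_lessThan_telescope[of "sqrt_iter z" n] by (metis sqrt_iter.simps(1) diff_zero)
  ultimately show ?thesis by (simp del: sqrt_iter.simps)
qed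

text \<open>The root is \<open>1 - b\<close> with \<open>b\<close> the limit of the iteration;
  self-adjointness and commutation pass from the iterates to \<open>b\<close>. The bound on
  \<open>1 - w\<close> permits a second extraction, from \<open>w\<close> itself.\<close>

lemma ex_sqrt:
  fixes z :: "'a::cstar_algebra"
  assumes "norm z \<le> 1" and "star z = z"
  obtains w where "w * w = 1 - z" "norm (1 - w) \<le> 1" "star w = w"
    "\<And>y. y * z = z * y \<Longrightarrow> y * w = w * y"
proof -
  obtain b where b: "sqrt_iter z \<longlonglongrightarrow> b"
    using convergent_sqrt_iter[OF assms(1)] convergent_def by blast
  have "(\<lambda>n. sqrt_iter z (Suc n)) \<longlonglongrightarrow> (1/2) *\<^sub>R (z + b * b)"
    unfolding sqrt_iter.simps by (intro tendsto_intros b)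
  then have "b = (1/2) *\<^sub>R (z + b * b)"
    using LIMSEQ_Suc[OF b] LIMSEQ_unique by blast
  then have bb: "b + b = z + b * b"
    by (metis scaleR_half_double scaleR_add_right)
  have nb: "norm b \<le> 1"
    by (rule LIMSEQ_le_const2[OF tendsto_norm[OF b]])
      (use norm_sqrt_iter[OF assms(1)] sqrt_iter_real_bounds order.trans in blast)
  have "star (sqrt_iter z n) = sqrt_iter z n" for n
    by (induction n) (simp_all add: star_add star_scaleR star_mult assms)
  then have sb: "star b = b"
    using bounded_linear.tendsto[OF bounded_linear_star b] b LIMSEQ_unique by fastforce
  have comm: "y * b = b * y" if y: "y * z = z * y" for y
  proof -
    have "y * sqrt_iter z n = sqrt_iter z n * y" for n
    proof (induction n)
      case (Suc n)
      then have "y * (sqrt_iter z n * sqrt_iter z n) = sqrt_iter z n * sqrt_iter z n * y"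
        by (metis mult.assoc)
      then show ?case by (simp add: algebra_simps y)
    qed simp
    then show ?thesis
      using tendsto_mult_left[OF b, of y] tendsto_mult_right[OF b, of y] LIMSEQ_unique by fastforce
  qed
  show ?thesis
  proof (rule that[of "1 - b"])
    show "(1 - b) * (1 - b) = 1 - z" using bb by (simp add: algebra_simps)
  qed (use nb sb comm in \<open>simp_all add: star_diff algebra_simps\<close>)
qed

subsection \<open>Positive and negative parts of a self-adjoint contraction\<close>

text \<open>If \<open>r = cos \<theta>\<close>, then \<open>1 - 2 r\<^sup>2 = - cos (2 \<theta>)\<close> is the real part of \<open>- u\<^sup>2\<close> for the
  unitary \<open>u = cos \<theta> + \<i> sin \<theta>\<close>.\<close>

lemma norm_one_minus_double_square:
  fixes r :: "'a::cstar_algebra"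
  assumes "star r = r" "norm r \<le> 1"
  shows "norm (1 - 2 *\<^sub>R (r * r)) \<le> 1"
proof -
  have "norm (r * r) \<le> 1"
    using assms by (simp add: norm_selfadjoint_square power_le_one)
  then obtain w where w: "w * w = 1 - r * r" "star w = w"
      "\<And>y. y * (r * r) = r * r * y \<Longrightarrow> y * w = w * y"
    using ex_sqrt[of "r * r"] assms(1) by (metis star_mult)
  have rw: "r * w = w * r" by (rule w(3)) (simp add: mult.assoc)
  define v where "v = cscale \<i> w"
  have vv: "v * v = - (w * w)"
    by (simp add: v_def cscale_left_mult[symmetric] cscale_right_mult[symmetric]
        cscale_mult[symmetric] cscale_minus_left cscale_one)
  have sv: "star v = - v"
    by (simp add: v_def star_cscale w cscale_minus_left)
  have rv: "r * v = v * r"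
    by (simp add: v_def cscale_left_mult[symmetric] cscale_right_mult[symmetric] rw)
  define u where "u = r + v"
  have su: "star u = r - v" by (simp add: u_def star_add sv assms)
  have "star u * u = 1" unfolding su by (simp add: u_def algebra_simps rv vv w(1))
  then have "(norm u)\<^sup>2 = 1" using cstar_identity[of u] by simp
  then have nu: "norm u = 1" by (metis norm_ge_zero power2_eq_1_iff neg_0_le_iff_le not_one_le_zero)
  have "2 *\<^sub>R (1 - 2 *\<^sub>R (r * r)) = - (u * u + star u * star u)"
    unfolding su by (simp add: u_def algebra_simps vv w(1) scaleR_2)
  moreover have "norm (u * u + star u * star u) \<le> 1 * 1 + 1 * 1"
    by (intro norm_triangle_le add_mono order.trans[OF norm_mult_ineq])
      (simp_all add: norm_star nu)
  ultimately have "norm (2 *\<^sub>R (1 - 2 *\<^sub>R (r * r))) \<le> 2" by (simp only: norm_minus_cancel)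
  then show ?thesis by simp
qed

text \<open>Exponential growth beats linear growth, already along the exponents
  \<open>2 ^ m\<close>.\<close>

lemma power_le_linear_imp_le_one:
  fixes y :: real
  assumes "\<And>m. y ^ (2 ^ m) \<le> 1 + c * 2 ^ m"
  shows "y \<le> 1"
proof (rule ccontr)
  assume "\<not> y \<le> 1"
  then have y: "y > 1" by simp
  have "(\<lambda>n::nat. (1 + c * real n) / y ^ n) \<longlonglongrightarrow> 0"
  proof -
    have "(\<lambda>n::nat. inverse (y ^ n) + c * (real n * (inverse y) ^ n)) \<longlonglongrightarrow> 0 + c * 0"
      by (intro tendsto_intros LIMSEQ_inverse_realpow_zero powser_times_n_limit_0 y)
        (use y in \<open>simp_all add: field_simps\<close>)
    then show ?thesis by (simp add: field_simps add_divide_distrib)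
  qed
  from LIMSEQ_subseq_LIMSEQ[OF this, of "\<lambda>m. 2 ^ m"]
  have "(\<lambda>m. (1 + c * 2 ^ m) / y ^ (2 ^ m)) \<longlonglongrightarrow> 0"
    by (simp add: o_def strict_mono_def)
  moreover have "1 \<le> (1 + c * 2 ^ m) / y ^ (2 ^ m)" for m
    using assms[of m] y by simp
  ultimately have "1 \<le> (0::real)" by (intro LIMSEQ_le_const) auto
  then show False by simp
qed

text \<open>Here \<open>a = \<bar>h\<bar>\<close>. As \<open>(a + h)\<^sup>2 = (a + h) (2 a)\<close>, the powers of \<open>1 - (a + h)\<close> grow at most
  linearly, while the norm is multiplicative on dyadic powers of self-adjoint elements.\<close>

lemma norm_one_minus_abs_plus:
  fixes a h :: "'a::cstar_algebra"
  assumes "star a = a" "star h = h" "a * h = h * a" "a * a = h * h" "norm (1 - 2 *\<^sub>R a) \<le> 1"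
  shows "norm (1 - (a + h)) \<le> 1"
proof (rule power_le_linear_imp_le_one[where c = "norm (a + h)"])
  fix m
  define y where "y = 1 - (a + h)"
  define v where "v = 1 - 2 *\<^sub>R a"
  \<comment> \<open>To the right of the factor \<open>a + h\<close>, \<open>y\<close> may be
    replaced by the contraction \<open>v\<close>.\<close>
  have step: "(a + h) * y = (a + h) * v" "v * y = y * v"
    unfolding y_def v_def using assms(3,4) by (simp_all add: algebra_simps scaleR_2)
  have yv: "(a + h) * v ^ k * y = (a + h) * v ^ Suc k" for k
  proof -
    have "v ^ k * y = y * v ^ k"
      by (induction k) (simp, metis power_Suc mult.assoc step(2))
    then show ?thesis by (metis mult.assoc power_Suc step(1))
  qed
  \<comment> \<open>Each further factor \<open>y\<close> shifts the sum by one power of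
    \<open>v\<close> and contributes the term for \<open>j = 0\<close>. The \<open>k\<close>
    summands are contractions, whence linear growth.\<close>
  have pow: "y ^ k = 1 - (a + h) * (\<Sum>j<k. v ^ j)" for k
  proof (induction k)
    case (Suc k)
    have "y ^ Suc k = y ^ k * y" by (simp add: power_commutes)
    also have "\<dots> = y - (\<Sum>j<k. (a + h) * v ^ j * y)"
      by (simp add: Suc left_diff_distrib sum_distrib_left sum_distrib_right)
    also have "\<dots> = 1 - ((a + h) * v ^ 0 + (\<Sum>j<k. (a + h) * v ^ Suc j))"
      unfolding yv by (simp add: y_def)
    also have "\<dots> = 1 - (\<Sum>j<Suc k. (a + h) * v ^ j)"
      by (subst sum.lessThan_Suc_shift) simp
    finally show ?case by (simp only: sum_distrib_left)
  qed simp
  have "norm (\<Sum>j<k. v ^ j) \<le> real k" for k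
  proof -
    have "norm (\<Sum>j<k. v ^ j) \<le> (\<Sum>j<k. 1)"
      by (intro sum_norm_le order.trans[OF norm_power_ineq] power_le_one)
        (use assms(5) in \<open>simp_all add: v_def\<close>)
    then show ?thesis by simp
  qed
  then have "norm (y ^ k) \<le> 1 + norm (a + h) * real k" for k
    unfolding pow
    by (intro order.trans[OF norm_triangle_ineq4] add_mono order.trans[OF norm_mult_ineq] mult_left_mono)
      simp_all
  from this[of "2 ^ m"]
  have "norm (y ^ (2 ^ m)) \<le> 1 + norm (a + h) * 2 ^ m" by simp
  then show "norm (1 - (a + h)) ^ (2 ^ m) \<le> 1 + norm (a + h) * 2 ^ m"
    by (subst (asm) norm_selfadjoint_power) (simp_all add: y_def star_diff star_add assms)
qed

text \<open>Take half of \<open>a + h\<close> and of \<open>a - h\<close> with \<open>a\<close> a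
  square root of \<open>h * h\<close> commuting with \<open>h\<close>; their product is a multiple
  of \<open>a * a - h * h = 0\<close>.\<close>

lemma ex_positive_negative_parts:
  fixes h :: "'a::cstar_algebra"
  assumes "star h = h" "norm h \<le> 1"
  obtains p q where "h = p - q" "p * q = 0" "q * p = 0" "star p = p" "star q = q"
    "norm (2 *\<^sub>R p - 1) \<le> 1" "norm (2 *\<^sub>R q - 1) \<le> 1"
proof -
  \<comment> \<open>An average of two elements of norm at most 1, so that \<open>ex_sqrt\<close>
    applies with \<open>z = 1 - h * h\<close>.\<close>
  have "1 - h * h = (1/2) *\<^sub>R (1 + (1 - 2 *\<^sub>R (h * h)))"
    by (simp add: algebra_simps flip: scaleR_2)
  then have "norm (1 - h * h) \<le> 1"
    using norm_triangle_ineq[of 1 "1 - 2 *\<^sub>R (h * h)"] norm_one_minus_double_square[OF assms]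
    by simp
  then obtain a where a: "a * a = h * h" "norm (1 - a) \<le> 1" "star a = a" "h * a = a * h"
  proof (rule ex_sqrt)
    fix w assume "w * w = 1 - (1 - h * h)" "norm (1 - w) \<le> 1" "star w = w"
      "\<And>y. y * (1 - h * h) = (1 - h * h) * y \<Longrightarrow> y * w = w * y"
    then show thesis by (intro that[of w]) (simp_all add: algebra_simps)
  qed (simp add: star_diff star_mult assms)
  \<comment> \<open>Writing \<open>a\<close> as a square encodes its positivity and yields the bound
    on \<open>1 - 2 *\<^sub>R a\<close>.\<close>
  obtain r where r: "r * r = a" "star r = r"
    using ex_sqrt[OF a(2)] a(3) by (metis star_diff star_one diff_diff_eq2 add_diff_cancel_left')
  have "(norm a)\<^sup>2 \<le> 1\<^sup>2"
    using a(1) norm_selfadjoint_square[OF a(3)] norm_selfadjoint_square[OF assms(1)] assms(2)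
    by (simp add: power_le_one)
  then have "norm a \<le> 1" using power2_le_imp_le zero_le_one by blast
  then have "(norm r)\<^sup>2 \<le> 1\<^sup>2"
    using norm_selfadjoint_square[OF r(2)] r(1) by simp
  then have "norm r \<le> 1" using power2_le_imp_le zero_le_one by blast
  then have na: "norm (1 - 2 *\<^sub>R a) \<le> 1"
    using norm_one_minus_double_square[OF r(2)] r(1) by simp
  have plus: "norm (1 - (a + h)) \<le> 1"
    by (rule norm_one_minus_abs_plus) (use a assms na in simp_all)
  \<comment> \<open>\<open>h\<close> and \<open>- h\<close> have the same square, so the same
    \<open>a\<close> serves for both.\<close>
  have minus: "norm (1 - (a + - h)) \<le> 1"
    by (rule norm_one_minus_abs_plus) (use a assms na in \<open>simp_all add: star_minus\<close>)
  show ?thesis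
  proof (rule that[of "(1/2) *\<^sub>R (a + h)" "(1/2) *\<^sub>R (a - h)"])
    show "h = (1/2) *\<^sub>R (a + h) - (1/2) *\<^sub>R (a - h)"
      by (simp add: algebra_simps flip: scaleR_add_left)
    show "norm (2 *\<^sub>R ((1/2) *\<^sub>R (a + h)) - 1) \<le> 1"
      using plus by (simp add: norm_minus_commute)
    show "norm (2 *\<^sub>R ((1/2) *\<^sub>R (a - h)) - 1) \<le> 1"
      using minus by (simp add: norm_minus_commute)
  qed (use a in \<open>simp_all add: star_scaleR star_add star_diff assms algebra_simps\<close>)
qed

subsection \<open>Linear maps that annihilate Jordan products of orthogonal elements\<close>

lemma continuous_linear_imp_bounded_linear:
  fixes g :: "'a::real_normed_vector \<Rightarrow> 'b::real_normed_vector"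
  assumes "linear g" "continuous_on UNIV g"
  shows "bounded_linear g"
proof -
  have "isCont g 0" using assms(2) by (simp add: continuous_on_eq_continuous_at)
  then obtain e where e: "e > 0" "\<And>x. norm x < e \<Longrightarrow> norm (g x) < 1"
    unfolding continuous_at_eps_delta by (metis dist_0_norm dist_commute linear_0[OF assms(1)] zero_less_one)
  have "norm (g x) \<le> norm x * (2 / e)" for x
  proof (cases "x = 0")
    case False
    define s where "s = e / (2 * norm x)"
    have s: "s > 0" using e False by (simp add: s_def)
    have "norm (s *\<^sub>R x) < e" using e False by (simp add: s_def)
    then have "norm (g (s *\<^sub>R x)) < 1" by (rule e(2))
    then have "s * norm (g x) < 1" using s by (simp add: linear_scale[OF assms(1)])
    then show ?thesis using e(1) False by (simp add: s_def field_simps)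
  qed (simp add: linear_0[OF assms(1)])
  then show ?thesis
    by (intro bounded_linear_intro[where K = "2 / e"]) (simp_all add: linear_add linear_scale assms(1))
qed

lemma jordan_if_annihilates_orthogonal:
  fixes \<theta> :: "'a::cstar_algebra \<Rightarrow> 'a"
  assumes lin: "clinear_map \<theta>" and cont: "continuous_on UNIV \<theta>" and one: "\<theta> 1 = 1"
    and orth: "\<And>p q. p * q = 0 \<Longrightarrow> q * p = 0 \<Longrightarrow> \<theta> p * \<theta> q + \<theta> q * \<theta> p = 0"
  shows "\<theta> (a * a) = \<theta> a * \<theta> a"
proof -
  have add: "\<theta> (x + y) = \<theta> x + \<theta> y" and scale: "\<theta> (cscale c x) = cscale c (\<theta> x)" for x y c
    using lin by (simp_all add: clinear_map_def)
  have scaleR: "\<theta> (r *\<^sub>R x) = r *\<^sub>R \<theta> x" for r x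
    using scale[of "of_real r" x] by (simp add: cscale_of_real)
  have linear: "linear \<theta>" by (intro linearI add scaleR)
  note diff = linear_diff[OF linear]
  obtain L where L: "L \<ge> 0" "\<And>x. norm (\<theta> x) \<le> norm x * L"
    using bounded_linear.nonneg_bounded[OF continuous_linear_imp_bounded_linear[OF linear cont]]
    by blast
  define Q where "Q x = \<theta> x * \<theta> x - \<theta> (x * x)" for x
  have Q_diff: "Q (p - q) = Q p + Q q" if "p * q = 0" "q * p = 0" for p q
    using orth[OF that] unfolding Q_def
    by (simp add: algebra_simps diff add that eq_neg_iff_add_eq_0)
  have Q_shift: "Q (2 *\<^sub>R x - 1) = 4 *\<^sub>R Q x" for x
    unfolding Q_def by (simp add: diff add scaleR one algebra_simps)
  \<comment> \<open>The start \<open>L\<^sup>2 + L\<close> bounds the two terms of \<open>Q\<close>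
    separately. In each step two bounds are added and the sum is divided by 4; \<open>h\<close> must
    vary, since the hypothesis is used at the shifted parts.\<close>
  have bound: "norm (Q h) \<le> (L\<^sup>2 + L) / 2 ^ n" if "star h = h" "norm h \<le> 1" for h n
    using that
  proof (induction n arbitrary: h)
    case 0
    have 1: "norm (\<theta> x) \<le> L" if "norm x \<le> 1" for x
      using L(2)[of x] mult_right_mono[OF that L(1)] by simp
    have "norm (\<theta> h * \<theta> h) \<le> L * L"
      using order.trans[OF norm_mult_ineq mult_mono[OF 1 1]] 0 L(1) by simp
    moreover have "norm (\<theta> (h * h)) \<le> L"
      using 0 by (intro 1) (simp add: norm_selfadjoint_square power_le_one)
    ultimately show ?case
      unfolding Q_def by (intro order.trans[OF norm_triangle_ineq4]) (simp add: power2_eq_square)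
  next
    case (Suc n)
    obtain p q where pq: "h = p - q" "p * q = 0" "q * p = 0" "star p = p" "star q = q"
      "norm (2 *\<^sub>R p - 1) \<le> 1" "norm (2 *\<^sub>R q - 1) \<le> 1"
      using ex_positive_negative_parts Suc.prems by metis
    have "4 *\<^sub>R Q h = Q (2 *\<^sub>R p - 1) + Q (2 *\<^sub>R q - 1)"
      unfolding Q_shift pq(1) Q_diff[OF pq(2,3)] by (rule scaleR_add_right)
    moreover have "norm (Q (2 *\<^sub>R p - 1)) \<le> (L\<^sup>2 + L) / 2 ^ n"
      "norm (Q (2 *\<^sub>R q - 1)) \<le> (L\<^sup>2 + L) / 2 ^ n"
      by (rule Suc.IH; simp add: star_diff star_scaleR pq)+
    ultimately have "norm (4 *\<^sub>R Q h) \<le> (L\<^sup>2 + L) / 2 ^ n + (L\<^sup>2 + L) / 2 ^ n"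
      by (simp only: norm_triangle_mono)
    then have "4 * norm (Q h) \<le> 2 * ((L\<^sup>2 + L) / 2 ^ n)" by simp
    then show ?case by (simp only: power_Suc divide_divide_eq_left[symmetric])
  qed
  have Q_contraction: "Q h = 0" if "star h = h" "norm h \<le> 1" for h
  proof -
    have "(\<lambda>n. (L\<^sup>2 + L) * inverse (2 ^ n)) \<longlonglongrightarrow> (L\<^sup>2 + L) * 0"
      by (intro tendsto_intros LIMSEQ_inverse_realpow_zero) simp
    then have "norm (Q h) \<le> (L\<^sup>2 + L) * 0"
      by (rule LIMSEQ_le_const) (use bound[OF that] in \<open>simp add: field_simps\<close>)
    then show ?thesis by simp
  qed
  have Q_scaleR: "Q (r *\<^sub>R x) = (r * r) *\<^sub>R Q x" for r x
    by (simp add: Q_def scaleR scaleR_diff_right)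
  have Q_selfadjoint: "Q h = 0" if "star h = h" for h
  proof (cases "h = 0")
    case True
    then show ?thesis using linear_0[OF linear] by (simp add: Q_def)
  next
    case False
    have "Q (inverse (norm h) *\<^sub>R h) = 0"
      by (rule Q_contraction) (use that False in \<open>simp_all add: star_scaleR\<close>)
    then show ?thesis using False by (simp add: Q_scaleR)
  qed
  define h where "h = (1/2) *\<^sub>R (a + star a)"
  define k where "k = (1/2) *\<^sub>R cscale (-\<i>) (a - star a)"
  have h: "star h = h" by (simp add: h_def star_scaleR star_add star_star add.commute)
  have k: "star k = k"
    by (simp add: k_def star_scaleR star_cscale star_minus star_diff star_star cscale_diff_right cscale_minus_left)
  have ik: "cscale \<i> k = (1/2) *\<^sub>R (a - star a)"
    unfolding k_def cscale_scaleR by (simp add: cscale_mult[symmetric] cscale_one)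
  have a: "a = h + cscale \<i> k"
    unfolding ik by (simp add: h_def algebra_simps flip: scaleR_add_left)
  \<comment> \<open>Polarization at \<open>h + k\<close>: the mixed term vanishes, and it is all
    that could survive in \<open>Q (h + cscale \<i> k)\<close>.\<close>
  have hk: "\<theta> h * \<theta> k + \<theta> k * \<theta> h = \<theta> (h * k + k * h)"
    using Q_selfadjoint[of "h + k"] Q_selfadjoint[of h] Q_selfadjoint[of k]
    by (simp add: star_add h k Q_def add algebra_simps)
  have "Q (h + cscale \<i> k)
      = Q h - Q k + cscale \<i> (\<theta> h * \<theta> k + \<theta> k * \<theta> h - \<theta> (h * k + k * h))"
    unfolding Q_def
    by (simp add: add diff scale cscale_add_right cscale_diff_right distrib_left distrib_right
        cscale_left_mult[symmetric] cscale_right_mult[symmetric] cscale_mult[symmetric] cscale_minus_left cscale_one)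
  then have "Q a = 0"
    by (simp add: a[symmetric] hk Q_selfadjoint h k)
  then show ?thesis by (simp add: Q_def)
qed

subsection \<open>Evaluation of multilinear polynomials\<close>

lemma multilin_eval_cscale:
  "multilin_eval d lam (\<lambda>i. cscale c (b i)) = cscale (c ^ d) (multilin_eval d lam b)"
proof -
  have "prod_list (map (\<lambda>i. cscale c (g i)) xs) = cscale (c ^ length xs) (prod_list (map g xs))"
    for g :: "nat \<Rightarrow> 'a" and xs
    by (induction xs) (simp_all add: cscale_one cscale_left_mult[symmetric]
        cscale_right_mult[symmetric] cscale_mult[symmetric] mult.commute)
  then show ?thesis
    by (simp add: multilin_eval_def cscale_sum_right cscale_mult[symmetric] mult.commute)
qed

text \<open>The \<open>dropWhile\<close> test asks whether 1 occurs after 0; distinctness makes each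
  occur at most once.\<close>

lemma prod_list_two_entries:
  fixes p q :: "'a::monoid_mult"
  assumes "distinct xs"
  shows "prod_list (map (\<lambda>i::nat. if i = 0 then p else if i = 1 then q else 1) xs) =
    (if 0 \<in> set xs \<and> 1 \<in> set xs
     then (if 1 \<in> set (dropWhile (\<lambda>i. i \<noteq> 0) xs) then p * q else q * p)
     else if 0 \<in> set xs then p else if 1 \<in> set xs then q else 1)"
  using assms by (induction xs) (auto dest: set_dropWhileD)

lemma multilin_eval_two_entries:
  fixes d :: nat and lam :: "(nat \<Rightarrow> nat) \<Rightarrow> complex"
  assumes "d \<ge> 2"
  obtains \<mu> \<nu> where "\<mu> + \<nu> = (\<Sum>\<sigma>\<in>{\<sigma>. \<sigma> permutes {0..<d}}. lam \<sigma>)"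
    "\<And>p q :: 'a::cstar_algebra. multilin_eval d lam (\<lambda>i. if i = 0 then p else if i = 1 then q else 1)
       = cscale \<mu> (p * q) + cscale \<nu> (q * p)"
proof -
  let ?P = "{\<sigma>. \<sigma> permutes {0..<d}}"
  \<comment> \<open>The permutations whose word has 0 before 1; they yield \<open>p * q\<close> and
    all others yield \<open>q * p\<close>. As \<open>d \<ge> 2\<close>, both indices always
    occur.\<close>
  define S where "S = {\<sigma>\<in>?P. 1 \<in> set (dropWhile (\<lambda>i. i \<noteq> 0) (map \<sigma> [0..<d]))}"
  have S: "S \<subseteq> ?P" "finite ?P" by (auto simp: S_def finite_permutations)
  show ?thesis
  proof (rule that[of "sum lam S" "sum lam (?P - S)"])
    show "sum lam S + sum lam (?P - S) = sum lam ?P"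
      using sum.subset_diff[OF S, of lam] by simp
    fix p q :: 'a
    let ?a = "\<lambda>i::nat. if i = 0 then p else if i = 1 then q else 1"
    have prod: "prod_list (map (\<lambda>i. ?a (\<sigma> i)) [0..<d]) = (if \<sigma> \<in> S then p * q else q * p)"
      if "\<sigma> \<in> ?P" for \<sigma>
    proof -
      have \<sigma>: "\<sigma> permutes {0..<d}" using that by simp
      have set: "set (map \<sigma> [0..<d]) = {0..<d}"
        using permutes_image[OF \<sigma>] by simp
      have dist: "distinct (map \<sigma> [0..<d])"
        using permutes_inj_on[OF \<sigma>] by (simp add: distinct_map)
      have "map (\<lambda>i. ?a (\<sigma> i)) [0..<d] = map ?a (map \<sigma> [0..<d])" by simp
      then show ?thesis
        using assms(1) that by (simp only: prod_list_two_entries[OF dist] set) (simp add: S_def)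
    qed
    have "multilin_eval d lam ?a
        = (\<Sum>\<sigma>\<in>?P. cscale (lam \<sigma>) (if \<sigma> \<in> S then p * q else q * p))"
      unfolding multilin_eval_def by (intro sum.cong refl) (simp only: prod)
    also have "\<dots> = (\<Sum>\<sigma>\<in>?P - S. cscale (lam \<sigma>) (q * p)) + (\<Sum>\<sigma>\<in>S. cscale (lam \<sigma>) (p * q))"
      by (subst sum.subset_diff[OF S]) (intro arg_cong2[of _ _ _ _ "(+)"] sum.cong; simp)
    finally show "multilin_eval d lam ?a
        = cscale (sum lam S) (p * q) + cscale (sum lam (?P - S)) (q * p)"
      by (simp only: cscale_sum_left add.commute)
  qed
qed

section \<open>From zeros of the polynomial to orthogonal pairs\<close>

theorem theorem3p2:
  fixes d :: nat and lam :: "(nat \<Rightarrow> nat) \<Rightarrow> complex"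
    and \<phi> :: "'a::cstar_algebra \<Rightarrow> 'a"
  assumes "d \<ge> 2"
    and "(\<Sum>\<sigma>\<in>{\<sigma>. \<sigma> permutes {0..<d}}. lam \<sigma>) \<noteq> 0"
    and "continuous_on UNIV \<phi>"
    and "surj \<phi>"
    and "clinear_map \<phi>"
    and "preserves_zeros d lam \<phi>"
    and "\<exists>c. c \<noteq> 0 \<and> \<phi> 1 = cscale c 1"
  shows "\<exists>\<alpha> \<theta>. clinear_map \<theta> \<and> surj \<theta> \<and> (\<forall>a. \<theta> (a * a) = \<theta> a * \<theta> a)
           \<and> (\<forall>a. \<phi> a = cscale \<alpha> (\<theta> a))"
proof -
  obtain c where c: "c \<noteq> 0" "\<phi> 1 = cscale c 1" using assms(7) by blast
  define \<theta> where "\<theta> x = cscale (inverse c) (\<phi> x)" for x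
  have \<phi>: "\<phi> x = cscale c (\<theta> x)" for x
    using c(1) by (simp add: \<theta>_def cscale_mult[symmetric] cscale_one)
  have lin: "clinear_map \<theta>"
    using assms(5) by (simp add: clinear_map_def \<theta>_def cscale_add_right cscale_mult[symmetric] mult.commute)
  have "bounded_linear (cscale (inverse c) :: 'a \<Rightarrow> 'a)"
    by (rule bounded_linear_intro[where K = "cmod (inverse c)"])
      (simp_all add: cscale_add_right cscale_scaleR norm_cscale)
  then have cont: "continuous_on UNIV \<theta>"
    unfolding \<theta>_def by (rule bounded_linear.continuous_on[OF _ assms(3)])
  have one: "\<theta> 1 = 1"
    using c by (simp add: \<theta>_def cscale_mult[symmetric] cscale_one)
  have surj: "surj \<theta>"
  proof (rule surjI)
    fix y
    show "\<theta> (inv \<phi> (cscale c y)) = y"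
      using c(1) by (simp add: \<theta>_def surj_f_inv_f[OF assms(4)] cscale_mult[symmetric] cscale_one)
  qed
  have zeros: "multilin_eval d lam (\<lambda>i. \<theta> (b i)) = 0" if "multilin_eval d lam b = 0" for b
  proof -
    have "multilin_eval d lam (\<phi> \<circ> b) = 0"
      using assms(6) that unfolding preserves_zeros_def by blast
    then show ?thesis by (simp add: \<theta>_def multilin_eval_cscale o_def)
  qed
  obtain \<mu> \<nu> where \<mu>\<nu>: "\<mu> + \<nu> = (\<Sum>\<sigma>\<in>{\<sigma>. \<sigma> permutes {0..<d}}. lam \<sigma>)"
    and eval: "\<And>p q :: 'a. multilin_eval d lam (\<lambda>i. if i = 0 then p else if i = 1 then q else 1)
       = cscale \<mu> (p * q) + cscale \<nu> (q * p)"
    by (rule multilin_eval_two_entries[OF assms(1), where lam = lam and 'a = 'a]) (rule that)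
  have half: "cscale \<mu> (\<theta> p * \<theta> q) + cscale \<nu> (\<theta> q * \<theta> p) = 0"
    if "p * q = 0" "q * p = 0" for p q
  proof -
    have "multilin_eval d lam (\<lambda>i. if i = 0 then p else if i = 1 then q else 1) = 0"
      by (simp only: eval that cscale_zero_right add_0)
    \<comment> \<open>Because \<open>\<theta> 1 = 1\<close>, the image tuple again has the shape
      covered by \<open>eval\<close>.\<close>
    from zeros[OF this] show ?thesis
      by (simp only: if_distrib[of \<theta>] one eval)
  qed
  have orth: "\<theta> p * \<theta> q + \<theta> q * \<theta> p = 0" if "p * q = 0" "q * p = 0" for p q
  proof -
    \<comment> \<open>Exchanging \<open>p\<close> and \<open>q\<close> and adding makes only
      \<open>\<mu> + \<nu>\<close> matter, the coefficient sum assumed nonzero.\<close>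
    have "cscale (\<mu> + \<nu>) (\<theta> p * \<theta> q + \<theta> q * \<theta> p) = 0"
      using arg_cong2[OF half[OF that] half[OF that(2,1)], of "(+)"]
      by (simp add: cscale_add_left cscale_add_right add_ac)
    then have "norm (cscale (\<mu> + \<nu>) (\<theta> p * \<theta> q + \<theta> q * \<theta> p)) = 0" by (simp only: norm_zero)
    then show ?thesis using assms(2) by (simp add: norm_cscale \<mu>\<nu>)
  qed
  show ?thesis
    by (intro exI[of _ c] exI[of _ \<theta>] conjI allI lin surj \<phi>
        jordan_if_annihilates_orthogonal[OF lin cont one orth])
qed

end
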